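(* If $X$ has the rGB1-IWei distribution with parameters $(\gamma,\theta,a,b,c)$, then its Rényi entropy $I_R(\rho)$ (where $\rho>0$, $\rho\neq1$) is given by $$I_R(\rho)=\frac{\rho}{1-\rho}\log\left(\frac{c}{B(a,b)}\right)+\frac{1}{1-\rho}\log\Gamma\left(\rho+\frac{\rho-1}{\theta}\right)-\log(\gamma\theta)+\frac{1}{1-\rho}\log\left(\sum_{j_1=0}^{\infty}\sum_{j_2=0}^{\infty}\frac{p_{j_1,\rho(b-1)+1}\;p_{j_2,\rho(ac-1)+j_1c+1}}{\left[(j_2+\rho)\gamma\right]^{\rho+\frac{\rho-1}{\theta}}}\right).$$
   Context: $\Gamma$ is the Gamma function and $B(a,b)=\Gamma(a)\Gamma(b)/\Gamma(a+b)$ is the Beta function. A positive random variable $X$ has the rGB1-IWei (reflected generalized beta of first type Inverse Weibull) distribution with parameters $\gamma,\theta,a,b,c>0$ if it has the density, for $x>0$, $$f(x)=\frac{c\,\gamma\,\theta\,x^{-\theta-1}e^{-\gamma x^{-\theta}}}{B(a,b)}\left[1-e^{-\gamma x^{-\theta}}\right]^{ac-1}\left(1-\left[1-e^{-\gamma x^{-\theta}}\right]^{c}\right)^{b-1}.$$ The Rényi entropy of $X$ is $I_R(\rho)=\frac{1}{1-\rho}\log\left[\int_0^\infty f(x)^\rho\,dx\right]$ for $\rho>0$, $\rho\ne1$. The coefficients are $p_{j,s}=\dfrac{(-1)^j\,\Gamma(s)}{\Gamma(s-j)\,\Gamma(j+1)}$, i.e. the coefficients of the power series $(1-z)^{s-1}=\sum_{j=0}^\infty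 p_{j,s}z^j$.
   Formalization: The printed formula is false unless γ=1 (a=b=c=θ=1, ρ=2 gives log(4γ), not log(4γ²)); the term log(γ)/(1−ρ) is added. It is also assumed that f^ρ is integrable on (0,∞) and Γ(ρ+(ρ−1)/θ)>0, so that both sides are defined; both are automatic for ρ>1. *)

theory Defs
  imports "HOL-Probability.Probability"
begin

definition rGB1_IWei_density ::
  "real \<Rightarrow> real \<Rightarrow> real \<Rightarrow> real \<Rightarrow> real \<Rightarrow> real \<Rightarrow> real" where
  "rGB1_IWei_density \<gamma> \<theta> a b c x =
     (if 0 < x then
        c * \<gamma> * \<theta> * x powr (- \<theta> - 1) * exp (- \<gamma> * x powr (- \<theta>)) / Beta a b
        * (1 - exp (- \<gamma> * x powr (- \<theta>))) powr (a * c - 1)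
        * (1 - (1 - exp (- \<gamma> * x powr (- \<theta>))) powr c) powr (b - 1)
      else 0)"

definition rGB1_IWei_distributed ::
  "'a measure \<Rightarrow> ('a \<Rightarrow> real) \<Rightarrow> real \<Rightarrow> real \<Rightarrow> real \<Rightarrow> real \<Rightarrow> real \<Rightarrow> bool" where
  "rGB1_IWei_distributed M X \<gamma> \<theta> a b c \<longleftrightarrow>
     distributed M lborel X (\<lambda>x. ennreal (rGB1_IWei_density \<gamma> \<theta> a b c x))"

text \<open>
  Only meaningful for a positive random variable with a density whose power \<open>\<rho>\<close> is integrable:
  the Bochner integral of a non-integrable function is 0.
\<close>

definition renyi_entropy :: "'a measure \<Rightarrow> ('a \<Rightarrow> real) \<Rightarrow> real \<Rightarrow> real" where
  "renyi_entropy M X \<rho> =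
     1 / (1 - \<rho>) *
     ln (LINT x:{0<..}|lborel. enn2real (RN_deriv lborel (distr M lborel X) x) powr \<rho>)"

text \<open>
  The quotient of Gamma values is undefined when \<open>s\<close> is a pole of the numerator
  (the library sets \<open>Gamma s = 0\<close> there); the coefficient is then the one of the binomial series,
  as it is for all other \<open>s\<close>. When only \<open>s - j\<close> is a pole, division by 0 gives the correct value 0.
\<close>

definition binom_coeff :: "nat \<Rightarrow> real \<Rightarrow> real" where
  "binom_coeff j s =
     (if s \<in> \<int>\<^sub>\<le>\<^sub>0 then (- 1) ^ j * ((s - 1) gchoose j)
      else (- 1) ^ j * Gamma s / (Gamma (s - real j) * Gamma (real j + 1)))"

lemma binom_coeff_gchoose: "binom_coeff j s = (- 1) ^ j * ((s - 1) gchoose j)"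
  using gbinomial_Gamma[of "s - 1" j]
  by (simp add: binom_coeff_def Gamma_fact algebra_simps)

lemma binom_coeff_sums:
  assumes "\<bar>z\<bar> < 1"
  shows "(\<lambda>j. binom_coeff j s * z ^ j) sums (1 - z) powr (s - 1)"
  using gen_binomial_real[of "- z" "s - 1"] assms
  by (simp add: binom_coeff_gchoose power_minus[of z] mult_ac)

definition rGB1_IWei_renyi_term ::
  "real \<Rightarrow> real \<Rightarrow> real \<Rightarrow> real \<Rightarrow> real \<Rightarrow> real \<Rightarrow> nat \<Rightarrow> nat \<Rightarrow> real" where
  "rGB1_IWei_renyi_term \<gamma> \<theta> a b c \<rho> j1 j2 =
     binom_coeff j1 (\<rho> * (b - 1) + 1)
     * binom_coeff j2 (\<rho> * (a * c - 1) + real j1 * c + 1)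
     / ((real j2 + \<rho>) * \<gamma>) powr (\<rho> + (\<rho> - 1) / \<theta>)"

end

theory Submission
  imports Defs "HOL-Real_Asymp.Real_Asymp"
begin

text \<open>
  The substitution \<open>t = \<gamma> x powr (- \<theta>)\<close> turns the integral of the \<open>\<rho>\<close>-th power of the density
  into a multiple of the integral of
  \<open>t powr (k - 1) * exp (- \<rho> t) * (1 - exp (- t)) powr (s - 1) * (1 - (1 - exp (- t)) powr c) powr (u - 1)\<close>
  over the positive half-line, where \<open>k = \<rho> + (\<rho> - 1) / \<theta>\<close>, \<open>s = \<rho> (a c - 1) + 1\<close> and
  \<open>u = \<rho> (b - 1) + 1\<close>. The last factor is expanded in powers of \<open>(1 - exp (- t)) powr c\<close>, then
  the resulting powers of \<open>1 - exp (- t)\<close> in powers of \<open>exp (- t)\<close>. Sum and integral may be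
  exchanged because binomial coefficients eventually have constant sign. If \<open>k < 0\<close> (which
  \<open>Gamma k > 0\<close> permits), the terms of the inner expansion are not integrable at 0;
  that expansion is then reached from positive \<open>k\<close> by integration by parts.
  Integrability of the whole integrand forces \<open>k + s > 1\<close>, which makes this work.
\<close>

section \<open>Change of variables on the half-line and scaled Gamma integrals\<close>

text \<open>The substitution rule for Lebesgue absolute integrability and the gauge integral
  transfers, since for Borel functions both notions agree with those of \<open>lborel\<close>. The
  equivalence matters: integrability of the density power has to be carried over to the new
  variable.\<close>

lemma set_integral_change_of_variables_lborel:
  fixes f g g' :: "real \<Rightarrow> real"
  assumes S: "S \<in> sets borel" "g ` S \<in> sets borel"
    and g: "\<And>x. x \<in> S \<Longrightarrow> (g has_field_derivative g' x) (at x)" "inj_on g S"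
    and meas: "f \<in> borel_measurable borel" "(\<lambda>x. \<bar>g' x\<bar> * f (g x)) \<in> borel_measurable borel"
  shows "set_integrable lborel S (\<lambda>x. \<bar>g' x\<bar> * f (g x)) \<longleftrightarrow> set_integrable lborel (g ` S) f"
    and "set_integrable lborel (g ` S) f \<Longrightarrow>
         (LINT x:S|lborel. \<bar>g' x\<bar> * f (g x)) = (LINT x:g ` S|lborel. f x)"
proof -
  have eq: "set_integrable lebesgue A h \<longleftrightarrow> set_integrable lborel A h"
    "set_integrable lborel A h \<Longrightarrow> integral A h = (LINT x:A|lborel. h x)"
    if "A \<in> sets borel" "h \<in> borel_measurable borel" for A and h :: "real \<Rightarrow> real"
  proof -
    have "(\<lambda>x. indicator A x *\<^sub>R h x) \<in> borel_measurable lborel"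
      using that by simp
    then show "set_integrable lebesgue A h \<longleftrightarrow> set_integrable lborel A h"
      unfolding set_integrable_def by (rule integrable_completion)
    show "integral A h = (LINT x:A|lborel. h x)" if "set_integrable lborel A h"
      using set_borel_integral_eq_integral(2)[OF that] by simp
  qed
  \<comment> \<open>As \<open>b\<close> is arbitrary, choosing the integral of either side for it
    yields both the equivalence and the equality of integrals.\<close>
  have *: "(\<lambda>x. \<bar>g' x\<bar> * f (g x)) absolutely_integrable_on S \<and>
             integral S (\<lambda>x. \<bar>g' x\<bar> * f (g x)) = b \<longleftrightarrow>
           f absolutely_integrable_on (g ` S) \<and> integral (g ` S) f = b" for b
    using S g by (intro has_absolute_integral_change_of_variables_1')
      (auto intro: has_field_derivative_at_within)
  show iff: "set_integrable lborel S (\<lambda>x. \<bar>g' x\<bar> * f (g x)) \<longleftrightarrow> set_integrable lborel (g ` S) f"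
    using * eq(1)[OF S(1) meas(2)] eq(1)[OF S(2) meas(1)] by blast
  show "(LINT x:S|lborel. \<bar>g' x\<bar> * f (g x)) = (LINT x:g ` S|lborel. f x)"
    if "set_integrable lborel (g ` S) f"
    using that iff *[of "integral (g ` S) f"] eq[OF S(1) meas(2)] eq[OF S(2) meas(1)] by auto
qed

lemma image_greaterThan_0_mult:
  fixes r :: real
  assumes "r > 0"
  shows "(\<lambda>x. r * x) ` {0<..} = {0<..}"
proof -
  have "x \<in> (\<lambda>x. r * x) ` {0<..}" if "x > 0" for x
    using that assms by (intro image_eqI[of _ _ "x / r"]) auto
  then show ?thesis using assms by auto
qed

text \<open>Euler's integral with \<open>r * t\<close> in place of \<open>t\<close>: the derivative
  contributes \<open>r\<close> and the power \<open>r powr (k - 1)\<close>.\<close>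

lemma Gamma_integral_scaled:
  fixes k r :: real
  assumes "k > 0" "r > 0"
  shows "set_integrable lborel {0<..} (\<lambda>t. t powr (k - 1) * exp (- (r * t)))"
    and "(LINT t:{0<..}|lborel. t powr (k - 1) * exp (- (r * t))) = Gamma k / r powr k"
proof -
  define f where "f = (\<lambda>t::real. t powr (k - 1) * exp (- t))"
  have f_meas [measurable]: "f \<in> borel_measurable borel" by (simp add: f_def)
  have "(\<integral>\<^sup>+t. ennreal (indicator {0<..} t * f t) \<partial>lborel) = ennreal (Gamma k)"
    unfolding Gamma_conv_nn_integral_real[OF assms(1)]
    by (intro nn_integral_cong) (auto simp: f_def indicator_def exp_minus field_simps)
  then have "has_bochner_integral lborel (\<lambda>t. indicator {0<..} t * f t) (Gamma k)"
    using assms by (intro has_bochner_integral_nn_integral) (auto simp: f_def)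
  then have f: "set_integrable lborel {0<..} f" "(LINT t:{0<..}|lborel. f t) = Gamma k"
    by (auto simp: has_bochner_integral_iff set_integrable_def set_lebesgue_integral_def)
  have img: "(\<lambda>x. r * x) ` {0<..} = {0<..}" using assms(2) by (rule image_greaterThan_0_mult)
  have *: "r * f (r * t) = r powr k * (t powr (k - 1) * exp (- (r * t)))" if "t > 0" for t
    using that assms by (simp add: f_def powr_mult powr_diff)
  have cv: "set_integrable lborel {0<..} (\<lambda>t. r * f (r * t))"
      "(LINT t:{0<..}|lborel. r * f (r * t)) = Gamma k"
    using set_integral_change_of_variables_lborel[of "{0<..}" "\<lambda>x. r * x" "\<lambda>_. r" f] f assms
    by (auto simp: img inj_on_def intro!: derivative_eq_intros)
  have "set_integrable lborel {0<..} (\<lambda>t. r powr k * (t powr (k - 1) * exp (- (r * t))))"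
    using cv(1) * by (subst set_integrable_cong[OF refl]) auto
  then show "set_integrable lborel {0<..} (\<lambda>t. t powr (k - 1) * exp (- (r * t)))"
    using assms by (subst (asm) set_integrable_mult_right_iff) auto
  have "(LINT t:{0<..}|lborel. r powr k * (t powr (k - 1) * exp (- (r * t)))) = Gamma k"
    using cv(2) * by (subst set_lebesgue_integral_cong[where g = "\<lambda>t. r * f (r * t)"]) auto
  then show "(LINT t:{0<..}|lborel. t powr (k - 1) * exp (- (r * t))) = Gamma k / r powr k"
    using assms by (simp add: field_simps)
qed

section \<open>Signed binomial coefficients and termwise integration\<close>

lemma binom_coeff_Suc: "real (Suc j) * binom_coeff (Suc j) s = (real j + 1 - s) * binom_coeff j s"
  using gbinomial_mult_1[of "s - 1" j] by (simp add: binom_coeff_gchoose algebra_simps)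

text \<open>Comparison of coefficients in the derivative of \<open>(1 - z) powr (s - 1)\<close>. It
  later matches a factor \<open>j\<close> with the shift from \<open>s\<close> to
  \<open>s - 1\<close> caused by integration by parts.\<close>

lemma binom_coeff_absorption: "real (Suc j) * binom_coeff (Suc j) s = (1 - s) * binom_coeff j (s - 1)"
proof -
  have "(- 1) ^ Suc j * (real (Suc j) * (s - 1 gchoose Suc j)) =
      (- 1) ^ Suc j * ((s - 1) * (s - 1 - 1 gchoose j))"
    by (simp only: gbinomial_absorption)
  then show ?thesis by (simp add: binom_coeff_gchoose algebra_simps)
qed

text \<open>Each coefficient is \<open>(j + 1 - s) / (j + 1)\<close> times its predecessor, and this
  factor is nonnegative once \<open>j \<ge> s - 1\<close>. If the coefficient at \<open>N\<close> is
  0, so are all later ones, in accordance with \<open>sgn 0 = 0\<close>.\<close>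

lemma binom_coeff_eventually_const_sign:
  obtains N where "\<And>j. j \<ge> N \<Longrightarrow> \<bar>binom_coeff j s\<bar> = sgn (binom_coeff N s) * binom_coeff j s"
proof -
  define N where "N = nat \<lceil>s\<rceil>"
  have "\<bar>binom_coeff j s\<bar> = sgn (binom_coeff N s) * binom_coeff j s" if "j \<ge> N" for j
    using that
  proof (induction j rule: dec_induct)
    case base
    then show ?case by (simp add: abs_sgn)
  next
    case (step j)
    define q where "q = (real j + 1 - s) / real (Suc j)"
    have "s \<le> real N" unfolding N_def by linarith
    then have "q \<ge> 0" using step.hyps by (simp add: q_def)
    moreover have "binom_coeff (Suc j) s = q * binom_coeff j s"
      using binom_coeff_Suc[of j s] by (simp add: q_def field_simps)
    ultimately have "\<bar>binom_coeff (Suc j) s\<bar> = q * \<bar>binom_coeff j s\<bar>"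
      by (simp add: abs_mult)
    also have "\<dots> = sgn (binom_coeff N s) * (q * binom_coeff j s)"
      unfolding step.IH by (simp only: mult.left_commute)
    finally show ?case unfolding \<open>binom_coeff (Suc j) s = q * binom_coeff j s\<close> .
  qed
  then show ?thesis using that by blast
qed

text \<open>The coefficients eventually have constant sign, so only finitely many terms of the series of
  absolute values differ from \<open>\<plusminus>\<close> the binomial series itself.\<close>

lemma binom_coeff_abs_sums_le:
  obtains C where "C \<ge> 0" "\<And>n z. 0 \<le> z \<Longrightarrow> z < 1 \<Longrightarrow>
    (\<Sum>j<n. \<bar>binom_coeff j s\<bar> * z ^ j) \<le> C + (1 - z) powr (s - 1)"
    "\<And>z. 0 \<le> z \<Longrightarrow> z < 1 \<Longrightarrow> summable (\<lambda>j. \<bar>binom_coeff j s\<bar> * z ^ j)"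
proof -
  obtain N where N: "\<And>j. j \<ge> N \<Longrightarrow> \<bar>binom_coeff j s\<bar> = sgn (binom_coeff N s) * binom_coeff j s"
    using binom_coeff_eventually_const_sign[of s] by blast
  define e where "e = sgn (binom_coeff N s)"
  have e: "\<bar>e\<bar> \<le> 1" by (simp add: e_def sgn_if)
  define C where "C = (\<Sum>j<N. 2 * \<bar>binom_coeff j s\<bar>)"
  define d where "d = (\<lambda>j. \<bar>binom_coeff j s\<bar> - e * binom_coeff j s)"
  have d0: "d j = 0" if "j \<notin> {..<N}" for j using N[of j] that by (simp add: d_def e_def)
  have "\<bar>e * binom_coeff j s\<bar> \<le> \<bar>binom_coeff j s\<bar>" for j
    using e mult_right_mono[of "\<bar>e\<bar>" 1 "\<bar>binom_coeff j s\<bar>"] by (simp add: abs_mult)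
  then have d: "0 \<le> d j \<and> d j \<le> 2 * \<bar>binom_coeff j s\<bar>" for j
    using abs_le_D1[of "e * binom_coeff j s" "\<bar>binom_coeff j s\<bar>"]
      abs_le_D2[of "e * binom_coeff j s" "\<bar>binom_coeff j s\<bar>"]
    unfolding d_def by simp
  have main: "(\<lambda>j. \<bar>binom_coeff j s\<bar> * z ^ j) sums
      ((\<Sum>j<N. d j * z ^ j) + e * (1 - z) powr (s - 1))" if z: "0 \<le> z" "z < 1" for z
  proof -
    have "(\<lambda>j. d j * z ^ j) sums (\<Sum>j<N. d j * z ^ j)"
      using d0 by (intro sums_finite) auto
    moreover have "(\<lambda>j. e * (binom_coeff j s * z ^ j)) sums (e * (1 - z) powr (s - 1))"
      using z by (intro sums_mult binom_coeff_sums) auto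
    ultimately have "(\<lambda>j. d j * z ^ j + e * (binom_coeff j s * z ^ j)) sums
        ((\<Sum>j<N. d j * z ^ j) + e * (1 - z) powr (s - 1))"
      by (rule sums_add)
    moreover have "d j * z ^ j + e * (binom_coeff j s * z ^ j) = \<bar>binom_coeff j s\<bar> * z ^ j" for j
      by (simp add: d_def left_diff_distrib)
    ultimately show ?thesis by (simp only:)
  qed
  have "(\<Sum>j<n. \<bar>binom_coeff j s\<bar> * z ^ j) \<le> C + (1 - z) powr (s - 1)"
    if z: "0 \<le> z" "z < 1" for n z
  proof -
    have "(\<Sum>j<n. \<bar>binom_coeff j s\<bar> * z ^ j) \<le> (\<Sum>j<N. d j * z ^ j) + e * (1 - z) powr (s - 1)"
      using sum_le_suminf[of "\<lambda>j. \<bar>binom_coeff j s\<bar> * z ^ j" "{..<n}"] main[OF z] z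
      by (simp add: sums_iff)
    also have "(\<Sum>j<N. d j * z ^ j) \<le> C"
      unfolding C_def
    proof (rule sum_mono)
      fix j
      have "d j * z ^ j \<le> d j * 1" using d z by (intro mult_left_mono power_le_one) auto
      then show "d j * z ^ j \<le> 2 * \<bar>binom_coeff j s\<bar>" using d[of j] by simp
    qed
    also have "e * (1 - z) powr (s - 1) \<le> (1 - z) powr (s - 1)"
      using e mult_right_mono[of e 1 "(1 - z) powr (s - 1)"] by simp
    finally show ?thesis by simp
  qed
  moreover have "summable (\<lambda>j. \<bar>binom_coeff j s\<bar> * z ^ j)" if "0 \<le> z" "z < 1" for z
    using main[OF that] by (rule sums_summable)
  moreover have "C \<ge> 0" by (auto simp: C_def intro: sum_nonneg)
  ultimately show ?thesis using that[of C] by simp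
qed

text \<open>Whatever the number of terms, the partial sums of absolute values are dominated by
  \<open>C * w + w * (1 - z) powr (s - 1)\<close>. Hence the integrals of the absolute values are
  summable, although \<open>z\<close> may come arbitrarily close to 1.\<close>

lemma sums_integral_binom_coeff:
  fixes w z :: "'a \<Rightarrow> real"
  assumes z: "\<And>x. x \<in> A \<Longrightarrow> 0 \<le> z x" "\<And>x. x \<in> A \<Longrightarrow> z x < 1"
    and w: "\<And>x. x \<in> A \<Longrightarrow> 0 \<le> w x"
    and A: "A \<in> sets M" and meas: "z \<in> borel_measurable M"
    and int: "set_integrable M A w" "set_integrable M A (\<lambda>x. w x * (1 - z x) powr (s - 1))"
  shows "(\<lambda>j. binom_coeff j s * (LINT x:A|M. w x * z x ^ j)) sums
         (LINT x:A|M. w x * (1 - z x) powr (s - 1))"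
proof -
  define f where "f = (\<lambda>j x. indicat_real A x *\<^sub>R (binom_coeff j s * (w x * z x ^ j)))"
  obtain C where C: "C \<ge> 0" "\<And>n y. 0 \<le> y \<Longrightarrow> y < 1 \<Longrightarrow>
      (\<Sum>j<n. \<bar>binom_coeff j s\<bar> * y ^ j) \<le> C + (1 - y) powr (s - 1)"
    "\<And>y. 0 \<le> y \<Longrightarrow> y < 1 \<Longrightarrow> summable (\<lambda>j. \<bar>binom_coeff j s\<bar> * y ^ j)"
    using binom_coeff_abs_sums_le[of s] by blast
  have f_int: "integrable M (f j)" for j
  proof -
    have "integrable M (\<lambda>x. indicator A x *\<^sub>R (w x * z x ^ j))"
    proof (rule Bochner_Integration.integrable_bound)
      show "integrable M (\<lambda>x. indicator A x *\<^sub>R w x)"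
        using int(1) by (simp add: set_integrable_def)
      then have "(\<lambda>x. (indicator A x *\<^sub>R w x) * z x ^ j) \<in> borel_measurable M"
        using meas by (intro borel_measurable_times borel_measurable_power) auto
      then show "(\<lambda>x. indicator A x *\<^sub>R (w x * z x ^ j)) \<in> borel_measurable M"
        by (simp add: mult_ac)
      show "AE x in M. norm (indicator A x *\<^sub>R (w x * z x ^ j)) \<le> norm (indicator A x *\<^sub>R w x)"
      proof (rule AE_I2)
        fix x
        show "norm (indicator A x *\<^sub>R (w x * z x ^ j)) \<le> norm (indicator A x *\<^sub>R w x)"
          using z[of x] w[of x] power_le_one[of "z x" j]
          by (auto simp: indicator_def abs_mult intro!: mult_left_le)
      qed
    qed
    then have "integrable M (\<lambda>x. binom_coeff j s * (indicator A x *\<^sub>R (w x * z x ^ j)))"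
      by (intro integrable_mult_right)
    then show ?thesis by (simp add: f_def mult_ac)
  qed
  have norm_f: "norm (f j x) = indicator A x * (w x * (\<bar>binom_coeff j s\<bar> * z x ^ j))" for j x
    using z[of x] w[of x] by (auto simp: f_def indicator_def abs_mult)
  have "(\<lambda>j. integral\<^sup>L M (f j)) sums (\<integral>x. (\<Sum>j. f j x) \<partial>M)"
  proof (rule sums_integral[OF f_int])
    show "AE x in M. summable (\<lambda>j. norm (f j x))"
    proof (rule AE_I2)
      fix x
      show "summable (\<lambda>j. norm (f j x))"
        unfolding norm_f using C(3)[of "z x"] z[of x]
        by (cases "x \<in> A") (auto intro!: summable_mult)
    qed
    show "summable (\<lambda>j. \<integral>x. norm (f j x) \<partial>M)"
    proof (rule summableI_nonneg_bounded)
      fix n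
      have "(\<Sum>j<n. \<integral>x. norm (f j x) \<partial>M) = (\<integral>x. (\<Sum>j<n. norm (f j x)) \<partial>M)"
        using f_int by (subst Bochner_Integration.integral_sum) auto
      also have "\<dots> \<le> (\<integral>x. C * (indicator A x *\<^sub>R w x) +
          indicator A x *\<^sub>R (w x * (1 - z x) powr (s - 1)) \<partial>M)"
      proof (rule integral_mono)
        show "integrable M (\<lambda>x. \<Sum>j<n. norm (f j x))" using f_int by auto
        show "integrable M (\<lambda>x. C * (indicator A x *\<^sub>R w x) +
          indicator A x *\<^sub>R (w x * (1 - z x) powr (s - 1)))"
          using int by (auto simp: set_integrable_def)
        fix x
        show "(\<Sum>j<n. norm (f j x)) \<le> C * (indicator A x *\<^sub>R w x) +
          indicator A x *\<^sub>R (w x * (1 - z x) powr (s - 1))"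
        proof (cases "x \<in> A")
          case True
          then have "w x * (\<Sum>j<n. \<bar>binom_coeff j s\<bar> * z x ^ j) \<le>
              w x * (C + (1 - z x) powr (s - 1))"
            using C(2)[of "z x" n] z[of x] w[of x] by (intro mult_left_mono) auto
          moreover have "(\<Sum>j<n. norm (f j x)) = w x * (\<Sum>j<n. \<bar>binom_coeff j s\<bar> * z x ^ j)"
            using True by (simp add: norm_f sum_distrib_left del: real_norm_def)
          moreover have "w x * (C + (1 - z x) powr (s - 1)) = C * w x + w x * (1 - z x) powr (s - 1)"
            by (simp add: distrib_left)
          ultimately show ?thesis using True by (simp del: real_norm_def)
        qed (simp add: norm_f del: real_norm_def)
      qed
      finally show "(\<Sum>j<n. \<integral>x. norm (f j x) \<partial>M) \<le> (\<integral>x. C * (indicator A x *\<^sub>R w x) +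
          indicator A x *\<^sub>R (w x * (1 - z x) powr (s - 1)) \<partial>M)" .
    qed auto
  qed
  moreover have "(\<Sum>j. f j x) = indicator A x *\<^sub>R (w x * (1 - z x) powr (s - 1))" for x
  proof (cases "x \<in> A")
    case True
    have "(\<lambda>j. w x * (binom_coeff j s * z x ^ j)) sums (w x * (1 - z x) powr (s - 1))"
      using True z[of x] by (intro sums_mult binom_coeff_sums) auto
    then show ?thesis using True by (simp add: f_def sums_iff mult_ac)
  qed (simp add: f_def)
  moreover have "integral\<^sup>L M (f j) = binom_coeff j s * (LINT x:A|M. w x * z x ^ j)" for j
    by (simp add: f_def set_lebesgue_integral_def mult_ac flip: integral_mult_right_zero)
  ultimately show ?thesis by (simp add: set_lebesgue_integral_def)
qed

section \<open>The kernel: bounds and integrability\<close>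

text \<open>On the positive half-line, \<open>s = 1\<close> gives a scaled Gamma integrand, and
  \<open>k = 1\<close> the integrand of \<open>Beta r s\<close> in the variable
  \<open>exp (- t)\<close>. Near 0 the kernel behaves like \<open>t powr (k + s - 2)\<close>, whence
  the recurring condition \<open>k + s > 1\<close>.\<close>

definition exp_beta_kernel :: "real \<Rightarrow> real \<Rightarrow> real \<Rightarrow> real \<Rightarrow> real" where
  "exp_beta_kernel k r s t = t powr (k - 1) * exp (- (r * t)) * (1 - exp (- t)) powr (s - 1)"

lemma measurable_exp_beta_kernel [measurable]: "exp_beta_kernel k r s \<in> borel_measurable borel"
  unfolding exp_beta_kernel_def by measurable

text \<open>The power increases or decreases in its base according to the sign of \<open>q\<close>;
  bounds in \<bar>q\<bar> cover both cases.\<close>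

lemma powr_between_bounds:
  fixes x y q :: real
  assumes "1 \<le> y" "1 / y \<le> x" "x \<le> 1"
  shows "x powr q \<le> y powr \<bar>q\<bar>" and "y powr - \<bar>q\<bar> \<le> x powr q"
proof -
  have x: "x > 0" using assms by (smt (verit) divide_pos_pos)
  have inv: "(1 / y) powr q = y powr (- q)"
    using assms by (simp add: powr_divide powr_minus_divide)
  have "x powr q \<le> y powr \<bar>q\<bar> \<and> y powr - \<bar>q\<bar> \<le> x powr q"
  proof (cases "q \<ge> 0")
    case True
    then have "(1 / y) powr q \<le> x powr q" "x powr q \<le> 1 powr q"
      using assms x by (intro powr_mono2; simp)+
    moreover have "y powr 0 \<le> y powr q" using assms True by (intro powr_mono) auto
    ultimately show ?thesis using assms True by (simp add: inv)
  next
    case False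
    then have "x powr q \<le> (1 / y) powr q" "1 powr q \<le> x powr q"
      using assms x by (intro powr_mono2'; simp)+
    moreover have "y powr q \<le> y powr 0" using assms False by (intro powr_mono) auto
    ultimately show ?thesis using assms False by (simp add: inv)
  qed
  then show "x powr q \<le> y powr \<bar>q\<bar>" "y powr - \<bar>q\<bar> \<le> x powr q" by auto
qed

text \<open>The quotient of \<open>1 - exp (- t)\<close> by \<open>t\<close> lies between
  \<open>1 / (1 + t)\<close> and 1, by \<open>exp x \<ge> 1 + x\<close> at \<open>x = t\<close> and
  \<open>x = - t\<close>.\<close>

lemma one_minus_exp_powr_bounds:
  fixes t q :: real
  assumes "t > 0"
  shows "(1 - exp (- t)) powr q \<le> t powr q * (1 + t) powr \<bar>q\<bar>"
    and "t powr q * (1 + t) powr - \<bar>q\<bar> \<le> (1 - exp (- t)) powr q"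
proof -
  define x where "x = (1 - exp (- t)) / t"
  have "1 - exp (- t) \<le> t" using exp_ge_add_one_self[of "- t"] by simp
  then have "x \<le> 1" using assms by (simp add: x_def)
  have "exp (- t) \<le> 1 / (1 + t)"
    using exp_ge_add_one_self[of t] assms by (simp add: exp_minus field_simps)
  then have "t / (1 + t) \<le> 1 - exp (- t)" using assms by (simp add: field_simps)
  then have "1 / (1 + t) \<le> x" using assms by (simp add: x_def field_simps)
  note b = powr_between_bounds[OF _ this \<open>x \<le> 1\<close>, of q]
  have eq: "(1 - exp (- t)) powr q = t powr q * x powr q"
    using assms by (simp add: x_def flip: powr_mult)
  show "(1 - exp (- t)) powr q \<le> t powr q * (1 + t) powr \<bar>q\<bar>"
    "t powr q * (1 + t) powr - \<bar>q\<bar> \<le> (1 - exp (- t)) powr q"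
    unfolding eq using b assms by (auto intro!: mult_left_mono)
qed

lemma one_plus_powr_le_exp:
  fixes m e :: real
  assumes "m \<ge> 0" "e > 0"
  obtains C where "C > 0" "\<And>t. t \<ge> 0 \<Longrightarrow> (1 + t) powr m \<le> C * exp (e * t)"
proof -
  \<comment> \<open>\<open>d \<le> 1\<close> gives \<open>d * (1 + t) \<le> exp (d * t)\<close>, and
    \<open>d * m \<le> e\<close> keeps the \<open>m\<close>-th power of this below
    \<open>exp (e * t)\<close>. The denominator \<open>m + 1\<close> admits
    \<open>m = 0\<close>.\<close>
  define d where "d = min 1 (e / (m + 1))"
  have d: "d > 0" "d \<le> 1" "d * m \<le> e"
  proof -
    show "d > 0" "d \<le> 1" using assms by (auto simp: d_def)
    have "d * m \<le> e / (m + 1) * m" using assms by (intro mult_right_mono) (auto simp: d_def)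
    also have "\<dots> \<le> e" using assms by (simp add: field_simps)
    finally show "d * m \<le> e" .
  qed
  have "(1 + t) powr m \<le> (1 / d) powr m * exp (e * t)" if t: "t \<ge> 0" for t
  proof -
    have "d * (1 + t) \<le> 1 + d * t" using d by (simp add: algebra_simps)
    also have "\<dots> \<le> exp (d * t)" by (rule exp_ge_add_one_self)
    finally have "(d * (1 + t)) powr m \<le> exp (d * t) powr m"
      using assms d t by (intro powr_mono2) auto
    also have "\<dots> = exp (d * m * t)" by (simp add: powr_def mult_ac)
    also have "\<dots> \<le> exp (e * t)" using d t by (auto intro: mult_right_mono)
    finally have "d powr m * (1 + t) powr m \<le> exp (e * t)"
      by (simp add: powr_mult)
    then show ?thesis using d by (simp add: powr_divide field_simps)
  qed
  then show ?thesis using that[of "(1 / d) powr m"] d by auto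
qed

text \<open>Half of the exponential decay absorbs the factor
  \<open>(1 + t) powr \<bar>s - 1\<bar>\<close>; a scaled Gamma integrand remains.\<close>

lemma exp_beta_kernel_le:
  assumes "r > 0"
  obtains C where "C > 0" "\<And>t. t > 0 \<Longrightarrow>
    exp_beta_kernel k r s t \<le> C * (t powr (k + s - 1 - 1) * exp (- (r / 2 * t)))"
proof -
  obtain C where C: "C > 0" "\<And>t. t \<ge> 0 \<Longrightarrow> (1 + t) powr \<bar>s - 1\<bar> \<le> C * exp (r / 2 * t)"
    using one_plus_powr_le_exp[of "\<bar>s - 1\<bar>" "r / 2"] assms by auto
  have "exp_beta_kernel k r s t \<le> C * (t powr (k + s - 1 - 1) * exp (- (r / 2 * t)))"
    if t: "t > 0" for t
  proof -
    have "exp_beta_kernel k r s t \<le>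
        t powr (k - 1) * exp (- (r * t)) * (t powr (s - 1) * (1 + t) powr \<bar>s - 1\<bar>)"
      unfolding exp_beta_kernel_def using one_minus_exp_powr_bounds[OF t]
      by (intro mult_left_mono) auto
    also have "\<dots> \<le> t powr (k - 1) * exp (- (r * t)) * (t powr (s - 1) * (C * exp (r / 2 * t)))"
      using C(2)[of t] t by (intro mult_left_mono) auto
    also have "\<dots> = C * ((t powr (k - 1) * t powr (s - 1)) * (exp (- (r * t)) * exp (r / 2 * t)))"
      by (simp only: mult_ac)
    also have "t powr (k - 1) * t powr (s - 1) = t powr (k + s - 1 - 1)"
      unfolding powr_add[symmetric] by (rule arg_cong[of _ _ "\<lambda>x. t powr x"]) simp
    also have "exp (- (r * t)) * exp (r / 2 * t) = exp (- (r / 2 * t))"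
      by (simp flip: exp_add)
    finally show ?thesis .
  qed
  then show ?thesis using that C by blast
qed

lemma exp_beta_kernel_nonneg: "exp_beta_kernel k r s t \<ge> 0"
  by (simp add: exp_beta_kernel_def)

lemma set_integrable_exp_beta_kernel:
  assumes "k + s > 1" "r > 0"
  shows "set_integrable lborel {0<..} (exp_beta_kernel k r s)"
proof -
  obtain C where C: "C > 0" "\<And>t. t > 0 \<Longrightarrow>
    exp_beta_kernel k r s t \<le> C * (t powr (k + s - 1 - 1) * exp (- (r / 2 * t)))"
    using exp_beta_kernel_le[OF assms(2), of k s] by blast
  show ?thesis
  proof (rule set_integrable_bound)
    show "set_integrable lborel {0<..} (\<lambda>t. C * (t powr (k + s - 1 - 1) * exp (- (r / 2 * t))))"
      using assms by (intro set_integrable_mult_right Gamma_integral_scaled) auto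
    show "set_borel_measurable lborel {0<..} (exp_beta_kernel k r s)"
      by (simp add: set_borel_measurable_def)
    show "AE t in lborel. t \<in> {0<..} \<longrightarrow> norm (exp_beta_kernel k r s t) \<le>
        norm (C * (t powr (k + s - 1 - 1) * exp (- (r / 2 * t))))"
      using C by (intro AE_I2) (auto simp: abs_mult exp_beta_kernel_nonneg)
  qed
qed

text \<open>If \<open>a \<le> 0\<close>, then \<open>f t \<ge> d / t\<close> on
  \<open>{0<..1}\<close>, whose integral from \<open>x\<close> to 1 is \<open>- d * ln x\<close>,
  unbounded as \<open>x\<close> tends to 0.\<close>

lemma set_integrable_ge_powr_imp_pos:
  fixes f :: "real \<Rightarrow> real"
  assumes int: "set_integrable lborel {0<..} f"
    and f: "\<And>t. 0 < t \<Longrightarrow> t \<le> 1 \<Longrightarrow> d * t powr (a - 1) \<le> f t" and d: "d > 0"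
  shows "a > 0"
proof (rule ccontr)
  assume "\<not> a > 0"
  then have a: "a \<le> 0" by simp
  have int': "set_integrable lborel {0<..1} f"
    using int by (rule set_integrable_subset) auto
  define I where "I = integral {0<..1} f"
  have bound: "- d * ln x \<le> I" if x: "0 < x" "x \<le> 1" for x
  proof -
    have "((\<lambda>t. d / t) has_integral (d * ln 1 - d * ln x)) {x..1}"
      using x by (intro fundamental_theorem_of_calculus)
        (auto simp: has_real_derivative_iff_has_vector_derivative[symmetric]
           intro!: derivative_eq_intros)
    then have "- d * ln x = integral {x..1} (\<lambda>t. d / t)" "(\<lambda>t. d / t) integrable_on {x..1}"
      by (auto simp: has_integral_iff)
    note this(1)
    also have "integral {x..1} (\<lambda>t. d / t) \<le> integral {x..1} f"
    proof (rule integral_le)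
      show "(\<lambda>t. d / t) integrable_on {x..1}" by fact
      show "f integrable_on {x..1}"
        using int by (intro set_borel_integral_eq_integral(1) set_integrable_subset[OF int])
          (use x in auto)
      fix t assume t: "t \<in> {x..1}"
      have "t powr (-1) \<le> t powr (a - 1)" using t x a by (intro powr_mono') auto
      then have "d * t powr (-1) \<le> d * t powr (a - 1)" using d by (intro mult_left_mono) auto
      also have "\<dots> \<le> f t" using t x by (intro f) auto
      also have "t powr (-1) = 1 / t" using t x by (simp add: powr_minus_divide)
      finally show "d / t \<le> f t" by simp
    qed
    also have "\<dots> \<le> I" unfolding I_def
    proof (rule integral_subset_le)
      show "f integrable_on {x..1}"
        using int by (intro set_borel_integral_eq_integral(1) set_integrable_subset[OF int])
          (use x in auto)
      show "f integrable_on {0<..1}"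
        using int' by (rule set_borel_integral_eq_integral(1))
      show "\<forall>t\<in>{0<..1}. 0 \<le> f t"
      proof
        fix t :: real assume "t \<in> {0<..1}"
        then have "d * t powr (a - 1) \<le> f t" by (intro f) auto
        moreover have "0 \<le> d * t powr (a - 1)" using d by simp
        ultimately show "0 \<le> f t" by linarith
      qed
    qed (use x in auto)
    finally show ?thesis .
  qed
  \<comment> \<open>This puts the point \<open>exp (- (I + 1) / d)\<close> into
    \<open>{0<..1}\<close>; there the bound reads \<open>I + 1 \<le> I\<close>.\<close>
  have "I \<ge> 0" using bound[of 1] by simp
  then have "(- I - 1) / d \<le> 0" using d by (intro divide_nonpos_pos) auto
  then have "- d * ln (exp (- (I + 1) / d)) \<le> I" by (intro bound) auto
  moreover have "- d * ln (exp (- (I + 1) / d)) = I + 1" using d by simp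
  ultimately show False by linarith
qed

section \<open>Integration by parts and the series of the kernel integral\<close>

text \<open>The kernel with \<open>k + 1\<close> in place of \<open>k\<close> tends to 0 at both
  ends, so its derivative integrates to 0. Differentiating the last factor produces
  \<open>exp (- t)\<close>, which raises \<open>r\<close> by 1 while \<open>s\<close> drops by
  1.\<close>

lemma exp_beta_kernel_by_parts:
  assumes "k + s > 1" "r > 0"
  shows "k * (LINT t:{0<..}|lborel. exp_beta_kernel k r s t) =
    r * (LINT t:{0<..}|lborel. exp_beta_kernel (k + 1) r s t)
    - (s - 1) * (LINT t:{0<..}|lborel. exp_beta_kernel (k + 1) (r + 1) (s - 1) t)"
proof -
  define F where "F = exp_beta_kernel (k + 1) r s"
  define f where "f = (\<lambda>t. k * exp_beta_kernel k r s t - r * exp_beta_kernel (k + 1) r s t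
    + (s - 1) * exp_beta_kernel (k + 1) (r + 1) (s - 1) t)"
  have int: "set_integrable lborel {0<..} (exp_beta_kernel k r s)"
    "set_integrable lborel {0<..} (exp_beta_kernel (k + 1) r s)"
    "set_integrable lborel {0<..} (exp_beta_kernel (k + 1) (r + 1) (s - 1))"
    using assms by (intro set_integrable_exp_beta_kernel; simp)+
  have deriv: "(F has_real_derivative f t) (at t)" if t: "t > 0" for t
  proof -
    have e: "exp (- ((r + 1) * t)) = exp (- (r * t)) * exp (- t)"
      by (simp add: algebra_simps flip: exp_add)
    have "((\<lambda>t. t powr (k + 1 - 1)) has_real_derivative k * t powr (k - 1)) (at t)"
      "((\<lambda>t. exp (- (r * t))) has_real_derivative - r * exp (- (r * t))) (at t)"
      "((\<lambda>t. (1 - exp (- t)) powr (s - 1)) has_real_derivative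
        (s - 1) * (1 - exp (- t)) powr (s - 1 - 1) * exp (- t)) (at t)"
      using t by (auto intro!: derivative_eq_intros)
    from DERIV_mult[OF DERIV_mult[OF this(1,2)] this(3)] show ?thesis
      unfolding F_def exp_beta_kernel_def[abs_def]
      by (rule DERIV_cong) (simp add: f_def exp_beta_kernel_def e, simp add: algebra_simps)
  qed
  obtain C where C: "C > 0" "\<And>t. t > 0 \<Longrightarrow>
    F t \<le> C * (t powr (k + 1 + s - 1 - 1) * exp (- (r / 2 * t)))"
    using exp_beta_kernel_le[OF assms(2), of "k + 1" s] unfolding F_def by blast
  \<comment> \<open>The exponent is \<open>k + s - 1\<close>, so the boundary term at 0 vanishes
    even for negative \<open>k\<close>.\<close>
  have pos: "k + 1 + s - 1 - 1 > 0" using assms by simp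
  have F_nonneg: "F t \<ge> 0" for t by (simp add: F_def exp_beta_kernel_nonneg)
  have lim0: "(F \<longlongrightarrow> 0) (at_right 0)"
  proof (rule tendsto_sandwich[of "\<lambda>_. 0"])
    show "((\<lambda>t. C * (t powr (k + 1 + s - 1 - 1) * exp (- (r / 2 * t)))) \<longlongrightarrow> 0) (at_right 0)"
      using pos assms(2) by real_asymp
    show "\<forall>\<^sub>F t in at_right 0. F t \<le> C * (t powr (k + 1 + s - 1 - 1) * exp (- (r / 2 * t)))"
      using C by (auto simp: eventually_at_right_field intro!: exI[of _ 1])
  qed (auto simp: F_nonneg)
  have lim_inf: "(F \<longlongrightarrow> 0) at_top"
  proof (rule tendsto_sandwich[of "\<lambda>_. 0"])
    show "((\<lambda>t. C * (t powr (k + 1 + s - 1 - 1) * exp (- (r / 2 * t)))) \<longlongrightarrow> 0) at_top"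
      using pos assms(2) by real_asymp
    show "\<forall>\<^sub>F t in at_top. F t \<le> C * (t powr (k + 1 + s - 1 - 1) * exp (- (r / 2 * t)))"
      using C(2) by (rule eventually_mono[OF eventually_gt_at_top[of 0]])
  qed (auto simp: F_nonneg)
  have f_int: "set_integrable lborel {0<..} f"
    unfolding f_def using int by (intro set_integral_add set_integral_diff set_integrable_mult_right)
  have "(LBINT t=0..\<infinity>. f t) = 0 - 0"
  proof (rule interval_integral_FTC_integrable[where F = F])
    show "(F has_vector_derivative f t) (at t)" if "0 < ereal t" for t
      using deriv[of t] that by (simp add: has_real_derivative_iff_has_vector_derivative)
    show "isCont f t" if "0 < ereal t" for t
      unfolding f_def exp_beta_kernel_def using that
      by (intro continuous_intros) auto
    show "set_integrable lborel (einterval 0 \<infinity>) f"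
      using f_int by (simp add: zero_ereal_def)
    show "((F \<circ> real_of_ereal) \<longlongrightarrow> 0) (at_right 0)"
      using lim0 by (simp add: zero_ereal_def ereal_tendsto_simps)
    show "((F \<circ> real_of_ereal) \<longlongrightarrow> 0) (at_left \<infinity>)"
      using lim_inf by (simp add: ereal_tendsto_simps)
  qed auto
  then have "(LINT t:{0<..}|lborel. f t) = 0"
    by (simp add: interval_lebesgue_integral_0_infty)
  moreover have "(LINT t:{0<..}|lborel. f t) =
      k * (LINT t:{0<..}|lborel. exp_beta_kernel k r s t)
    - r * (LINT t:{0<..}|lborel. exp_beta_kernel (k + 1) r s t)
    + (s - 1) * (LINT t:{0<..}|lborel. exp_beta_kernel (k + 1) (r + 1) (s - 1) t)"
    unfolding f_def using int
    by (simp add: set_integral_add set_integral_diff set_integrable_mult_right)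
  ultimately show ?thesis by simp
qed

text \<open>Expansion in powers of \<open>exp (- t)\<close>; each term is a scaled Gamma integral,
  convergent because \<open>k > 0\<close>.\<close>

lemma exp_beta_kernel_sums_pos:
  assumes "k > 0" "k + s > 1" "r > 0"
  shows "(\<lambda>j. Gamma k * (binom_coeff j s / (r + real j) powr k)) sums
    (LINT t:{0<..}|lborel. exp_beta_kernel k r s t)"
proof -
  have "(\<lambda>j. binom_coeff j s *
      (LINT t:{0<..}|lborel. (t powr (k - 1) * exp (- (r * t))) * exp (- t) ^ j)) sums
    (LINT t:{0<..}|lborel. (t powr (k - 1) * exp (- (r * t))) * (1 - exp (- t)) powr (s - 1))"
  proof (rule sums_integral_binom_coeff)
    show "set_integrable lborel {0<..} (\<lambda>t. t powr (k - 1) * exp (- (r * t)))"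
      using assms by (intro Gamma_integral_scaled) auto
    show "set_integrable lborel {0<..}
        (\<lambda>t. t powr (k - 1) * exp (- (r * t)) * (1 - exp (- t)) powr (s - 1))"
      using set_integrable_exp_beta_kernel[OF assms(2,3)]
      by (simp add: exp_beta_kernel_def[abs_def])
  qed auto
  moreover have "(\<lambda>t::real. (t powr (k - 1) * exp (- (r * t))) * exp (- t) ^ j) =
      (\<lambda>t. t powr (k - 1) * exp (- ((r + real j) * t)))" for j
    by (rule ext) (simp add: algebra_simps flip: exp_of_nat_mult exp_add)
  moreover have "(LINT t:{0<..}|lborel. t powr (k - 1) * exp (- ((r + real j) * t))) =
      Gamma k / (r + real j) powr k" for j
    using assms by (intro Gamma_integral_scaled) auto
  ultimately have "(\<lambda>j. binom_coeff j s * (Gamma k / (r + real j) powr k)) sums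
      (LINT t:{0<..}|lborel. exp_beta_kernel k r s t)"
    by (simp only: exp_beta_kernel_def)
  then show ?thesis by (simp add: mult.commute)
qed

text \<open>For \<open>k < 0\<close> the integrals of the single terms diverge at 0; integration by parts
  replaces \<open>k\<close> by \<open>k + 1\<close>, which is the analytic continuation in \<open>k\<close> in discrete steps.\<close>

lemma exp_beta_kernel_sums:
  assumes "k \<notin> \<int>\<^sub>\<le>\<^sub>0" "k + s > 1" "r > 0"
  shows "(\<lambda>j. Gamma k * (binom_coeff j s / (r + real j) powr k)) sums
    (LINT t:{0<..}|lborel. exp_beta_kernel k r s t)"
proof -
  have "(\<lambda>j. Gamma k * (binom_coeff j s / (r + real j) powr k)) sums
      (LINT t:{0<..}|lborel. exp_beta_kernel k r s t)" if "k + real n > 0" for n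
    using that assms
  \<comment> \<open>Here \<open>n\<close> unit shifts make \<open>k\<close> positive. Each shift
    also changes \<open>r\<close> and \<open>s\<close>, but never lowers
    \<open>k + s\<close>.\<close>
  proof (induction n arbitrary: k r s)
    case 0
    then show ?case by (intro exp_beta_kernel_sums_pos) auto
  next
    case (Suc n)
    let ?I = "\<lambda>k r s. LINT t:{0<..}|lborel. exp_beta_kernel k r s t"
    have k0: "k \<noteq> 0" using Suc.prems by auto
    have k1: "k + 1 \<notin> \<int>\<^sub>\<le>\<^sub>0"
      using Suc.prems(2) plus_one_in_nonpos_Ints_imp by blast
    define A where "A = (\<lambda>j. Gamma (k + 1) * (binom_coeff j s / (r + real j) powr (k + 1)))"
    define B where "B = (\<lambda>j. Gamma (k + 1) *
      (binom_coeff j (s - 1) / (r + 1 + real j) powr (k + 1)))"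
    have A: "A sums ?I (k + 1) r s"
      unfolding A_def using Suc.prems k1 by (intro Suc.IH) auto
    have B: "B sums ?I (k + 1) (r + 1) (s - 1)"
      unfolding B_def using Suc.prems k1 by (intro Suc.IH) auto
    have Suc_A: "real (Suc j) * A (Suc j) = (1 - s) * B j" for j
    proof -
      have "real (Suc j) * A (Suc j) =
          Gamma (k + 1) * (real (Suc j) * binom_coeff (Suc j) s / (r + 1 + real j) powr (k + 1))"
        by (simp add: A_def add_ac)
      then show ?thesis unfolding binom_coeff_absorption by (simp add: B_def)
    qed
    have "(\<lambda>j. real (Suc j) * A (Suc j)) sums ((1 - s) * ?I (k + 1) (r + 1) (s - 1))"
      unfolding Suc_A using B by (rule sums_mult)
    \<comment> \<open>The term at index 0 is 0, so the index shift leaves the sum unchanged.\<close>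
    then have "(\<lambda>j. real j * A j) sums ((1 - s) * ?I (k + 1) (r + 1) (s - 1))"
      by (subst (asm) sums_Suc_iff) auto
    then have "(\<lambda>j. r * A j + real j * A j) sums
        (r * ?I (k + 1) r s + (1 - s) * ?I (k + 1) (r + 1) (s - 1))"
      by (intro sums_add sums_mult A)
    also have "r * ?I (k + 1) r s + (1 - s) * ?I (k + 1) (r + 1) (s - 1) = k * ?I k r s"
      using exp_beta_kernel_by_parts[of k s r] Suc.prems by (simp add: algebra_simps)
    finally have "(\<lambda>j. (r * A j + real j * A j) / k) sums ?I k r s"
      using k0 by (auto dest: sums_divide[of _ _ k])
    \<comment> \<open>The factor \<open>r + real j\<close> cancels one power in the denominator, and
      \<open>Gamma (k + 1) = k * Gamma k\<close> cancels the division by \<open>k\<close>.\<close>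
    moreover have "(r * A j + real j * A j) / k =
        Gamma k * (binom_coeff j s / (r + real j) powr k)" for j
    proof -
      have pos: "r + real j > 0" using Suc.prems by simp
      then have "r * A j + real j * A j =
          Gamma (k + 1) * binom_coeff j s * ((r + real j) / (r + real j) powr (k + 1))"
        by (simp add: A_def algebra_simps add_divide_distrib)
      also have "(r + real j) / (r + real j) powr (k + 1) = 1 / (r + real j) powr k"
        using pos by (simp add: powr_add)
      finally show ?thesis using k0 Suc.prems(2) by (simp add: Gamma_plus1)
    qed
    ultimately show ?case by simp
  qed
  moreover have "\<exists>n::nat. k + real n > 0"
  proof -
    obtain n :: nat where "- k < real n" using reals_Archimedean2 by blast
    then have "k + real n > 0" by linarith
    then show ?thesis ..
  qed
  ultimately show ?thesis by blast
qed

section \<open>The kernel weighted by the remaining factor of the density\<close>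

lemma one_minus_exp_powr_in_01:
  fixes t c :: real
  assumes "t > 0" "c > 0"
  shows "0 < (1 - exp (- t)) powr c" "(1 - exp (- t)) powr c < 1"
proof -
  have "0 < 1 - exp (- t)" "1 - exp (- t) < 1" using assms by auto
  then show "0 < (1 - exp (- t)) powr c" "(1 - exp (- t)) powr c < 1"
    using assms powr_less_mono2[of c "1 - exp (- t)" 1] by auto
qed

text \<open>On \<open>{0<..1}\<close> the integrand is at least a positive constant times
  \<open>t powr (k + s - 2)\<close>, which is not integrable at 0 unless
  \<open>k + s > 1\<close>.\<close>

lemma exp_beta_kernel_weighted_integrableD:
  assumes "c > 0"
    and "set_integrable lborel {0<..}
      (\<lambda>t. exp_beta_kernel k r s t * (1 - (1 - exp (- t)) powr c) powr p)" (is "set_integrable _ _ ?G")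
  shows "k + s > 1"
proof -
  \<comment> \<open>The base of the weight decreases in \<open>t\<close>, so on
    \<open>{0<..1}\<close> it is smallest at 1, with value \<open>1 / y\<close>.\<close>
  define y where "y = 1 / (1 - (1 - exp (- 1)) powr c)"
  have y: "y \<ge> 1" "1 / y = 1 - (1 - exp (- 1)) powr c"
  proof -
    define h where "h = (1 - exp (- 1 :: real)) powr c"
    have "0 < h" "h < 1"
      using one_minus_exp_powr_in_01[of 1 c, OF zero_less_one assms(1)] by (simp_all only: h_def)
    then show "y \<ge> 1" "1 / y = 1 - (1 - exp (- 1)) powr c"
      unfolding y_def h_def[symmetric] by (simp_all add: field_simps)
  qed
  define d where "d = exp (- \<bar>r\<bar>) * 2 powr - \<bar>s - 1\<bar> * y powr - \<bar>p\<bar>"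
  have "d > 0" using y by (simp add: d_def)
  have "d * t powr (k + s - 1 - 1) \<le> ?G t" if t: "0 < t" "t \<le> 1" for t
  proof -
    have "r * t \<le> \<bar>r\<bar> * 1" using t by (intro mult_mono) auto
    then have 1: "exp (- \<bar>r\<bar>) \<le> exp (- (r * t))" by simp
    have "2 powr - \<bar>s - 1\<bar> \<le> (1 + t) powr - \<bar>s - 1\<bar>"
      using t by (intro powr_mono2') auto
    then have "t powr (s - 1) * 2 powr - \<bar>s - 1\<bar> \<le> t powr (s - 1) * (1 + t) powr - \<bar>s - 1\<bar>"
      by (intro mult_left_mono) auto
    also have "\<dots> \<le> (1 - exp (- t)) powr (s - 1)"
      by (rule one_minus_exp_powr_bounds(2)[OF t(1)])
    finally have 2: "t powr (s - 1) * 2 powr - \<bar>s - 1\<bar> \<le> (1 - exp (- t)) powr (s - 1)" .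
    have "(1 - exp (- t)) powr c \<le> (1 - exp (- 1)) powr c"
      using t assms by (intro powr_mono2) auto
    then have 3: "y powr - \<bar>p\<bar> \<le> (1 - (1 - exp (- t)) powr c) powr p"
      using y one_minus_exp_powr_in_01[OF t(1) assms(1)]
      by (intro powr_between_bounds) auto
    have "t powr (k + s - 1 - 1) = t powr (k - 1) * t powr (s - 1)"
      unfolding powr_add[symmetric] by (rule arg_cong[of _ _ "\<lambda>x. t powr x"]) simp
    then have "d * t powr (k + s - 1 - 1) = d * (t powr (k - 1) * t powr (s - 1))"
      by (rule arg_cong)
    also have "\<dots> = t powr (k - 1) * exp (- \<bar>r\<bar>) * (t powr (s - 1) * 2 powr - \<bar>s - 1\<bar>) * y powr - \<bar>p\<bar>"
      by (simp only: d_def mult_ac)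
    also have "\<dots> \<le> ?G t"
      unfolding exp_beta_kernel_def
      by (rule mult_mono[OF mult_mono[OF mult_left_mono[OF 1] 2] 3]) simp_all
    finally show ?thesis .
  qed
  then have "k + s - 1 > 0"
    using set_integrable_ge_powr_imp_pos[OF assms(2), of d "k + s - 1"] \<open>d > 0\<close> by blast
  then show ?thesis by simp
qed

text \<open>Termwise integration with the kernel as weight: the \<open>j\<close>-th power of
  \<open>(1 - exp (- t)) powr c\<close> merely raises \<open>s\<close> by
  \<open>real j * c\<close>.\<close>

lemma exp_beta_kernel_weighted_sums:
  assumes "c > 0" "r > 0"
    and int: "set_integrable lborel {0<..}
      (\<lambda>t. exp_beta_kernel k r s t * (1 - (1 - exp (- t)) powr c) powr (u - 1))"
  shows "(\<lambda>j. binom_coeff j u * (LINT t:{0<..}|lborel. exp_beta_kernel k r (s + real j * c) t)) sums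
    (LINT t:{0<..}|lborel. exp_beta_kernel k r s t * (1 - (1 - exp (- t)) powr c) powr (u - 1))"
proof -
  have ks: "k + s > 1" using exp_beta_kernel_weighted_integrableD[OF assms(1) int] .
  have "(\<lambda>j. binom_coeff j u *
      (LINT t:{0<..}|lborel. exp_beta_kernel k r s t * ((1 - exp (- t)) powr c) ^ j)) sums
    (LINT t:{0<..}|lborel. exp_beta_kernel k r s t * (1 - (1 - exp (- t)) powr c) powr (u - 1))"
    using one_minus_exp_powr_in_01[OF _ assms(1)] set_integrable_exp_beta_kernel[OF ks assms(2)]
    by (intro sums_integral_binom_coeff int) (auto simp: exp_beta_kernel_nonneg)
  moreover have "(LINT t:{0<..}|lborel. exp_beta_kernel k r s t * ((1 - exp (- t)) powr c) ^ j) =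
      (LINT t:{0<..}|lborel. exp_beta_kernel k r (s + real j * c) t)" for j
  proof (intro set_lebesgue_integral_cong allI impI)
    fix t :: real assume "t \<in> {0<..}"
    then have "((1 - exp (- t)) powr c) ^ j = (1 - exp (- t)) powr (real j * c)"
      by (simp add: powr_powr powr_realpow[symmetric] mult.commute)
    moreover have "s + real j * c - 1 = (s - 1) + real j * c" by simp
    ultimately show "exp_beta_kernel k r s t * ((1 - exp (- t)) powr c) ^ j =
        exp_beta_kernel k r (s + real j * c) t"
      unfolding exp_beta_kernel_def by (simp only: powr_add mult_ac)
  qed auto
  ultimately show ?thesis by simp
qed

section \<open>From the entropy to the weighted kernel integral\<close>

lemma set_integral_pos_lborel:
  fixes f :: "real \<Rightarrow> real"
  assumes "set_integrable lborel {0<..} f" "\<And>t. t > 0 \<Longrightarrow> f t > 0"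
  shows "(LINT t:{0<..}|lborel. f t) > 0"
proof -
  let ?f = "\<lambda>t. indicator {0<..} t *\<^sub>R f t"
  have nonneg: "AE t in lborel. 0 \<le> ?f t"
    using assms(2) by (intro AE_I2) (auto simp: indicator_def less_imp_le)
  have "integral\<^sup>L lborel ?f \<noteq> 0"
  proof
    assume "integral\<^sup>L lborel ?f = 0"
    then have "AE t in lborel. ?f t = 0"
      using integral_nonneg_eq_0_iff_AE[OF _ nonneg] assms(1) by (simp add: set_integrable_def)
    then have "AE t in lborel. t \<notin> {0<..<1::real}"
      by eventually_elim (use assms(2) in \<open>force simp: indicator_def split: if_splits\<close>)
    then have "{0<..<1::real} \<in> null_sets lborel" by (subst AE_iff_null_sets) auto
    then show False by (auto simp: null_sets_def)
  qed
  moreover have "integral\<^sup>L lborel ?f \<ge> 0" by (rule integral_nonneg_AE[OF nonneg])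
  ultimately show ?thesis by (simp add: set_lebesgue_integral_def)
qed

text \<open>The Radon-Nikodym derivative is determined almost everywhere, which suffices under the
  integral; \<open>enn2real\<close> recovers \<open>f\<close> because \<open>f\<close> is
  nonnegative.\<close>

lemma renyi_entropy_distributed:
  assumes "distributed M lborel X (\<lambda>x. ennreal (f x))" "\<And>x. f x \<ge> 0" "f \<in> borel_measurable borel"
  shows "renyi_entropy M X \<rho> = 1 / (1 - \<rho>) * ln (LINT x:{0<..}|lborel. f x powr \<rho>)"
proof -
  have "AE x in lborel. ennreal (f x) = RN_deriv lborel (distr M lborel X) x"
    using assms by (intro sigma_finite_measure.RN_deriv_unique[OF sigma_finite_lborel] distributed_borel_measurable[OF assms(1)]
        distributed_distr_eq_density[OF assms(1), symmetric])
  then have ae: "AE x in lborel. enn2real (RN_deriv lborel (distr M lborel X) x) = f x"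
    by eventually_elim (use assms(2) in \<open>metis enn2real_ennreal\<close>)
  have "(LINT x:{0<..}|lborel. enn2real (RN_deriv lborel (distr M lborel X) x) powr \<rho>) =
      (LINT x:{0<..}|lborel. f x powr \<rho>)"
    unfolding set_lebesgue_integral_def
    using ae assms(3) by (intro integral_cong_AE) auto
  then show ?thesis by (simp add: renyi_entropy_def)
qed

lemma image_powr_greaterThan_0:
  fixes \<gamma> \<theta> :: real
  assumes "\<gamma> > 0" "\<theta> > 0"
  shows "(\<lambda>x. \<gamma> * x powr - \<theta>) ` {0<..} = {0<..}"
proof -
  have "t \<in> (\<lambda>x. \<gamma> * x powr - \<theta>) ` {0<..}" if "t > 0" for t
    using that assms by (intro image_eqI[of _ _ "(t / \<gamma>) powr (- 1 / \<theta>)"]) (auto simp: powr_powr)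
  then show ?thesis using assms by auto
qed

text \<open>This is the substitution \<open>t = \<gamma> * x powr - \<theta>\<close>. The exponent
  ending in \<open>+ 1 - 1\<close> stays unsimplified so that it can be folded to
  \<open>u - 1\<close>.\<close>

lemma rGB1_IWei_density_power_change_of_variables:
  fixes \<gamma> \<theta> a b c \<rho> :: real
  assumes "0 < \<gamma>" "0 < \<theta>" "0 < a" "0 < b" "0 < c"
  defines "k \<equiv> \<rho> + (\<rho> - 1) / \<theta>"
  defines "G \<equiv> \<lambda>t. exp_beta_kernel k \<rho> (\<rho> * (a * c - 1) + 1) t
      * (1 - (1 - exp (- t)) powr c) powr (\<rho> * (b - 1) + 1 - 1)"
  assumes int: "set_integrable lborel {0<..} (\<lambda>x. rGB1_IWei_density \<gamma> \<theta> a b c x powr \<rho>)"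
  shows "set_integrable lborel {0<..} G"
    and "(LINT x:{0<..}|lborel. rGB1_IWei_density \<gamma> \<theta> a b c x powr \<rho>) =
      (c * \<gamma> * \<theta> / Beta a b) powr \<rho> / (\<theta> * \<gamma> powr k) * (LINT t:{0<..}|lborel. G t)"
proof -
  define D where "D = (c * \<gamma> * \<theta> / Beta a b) powr \<rho> / (\<theta> * \<gamma> powr k)"
  define g where "g = (\<lambda>x::real. \<gamma> * x powr - \<theta>)"
  define g' where "g' = (\<lambda>x::real. \<gamma> * (- \<theta> * x powr (- \<theta> - 1)))"
  have Beta_pos: "Beta a b > 0" using assms by (simp add: Beta_def)
  have D: "D > 0" using assms Beta_pos by (simp add: D_def)
  have G_meas: "G \<in> borel_measurable borel" unfolding G_def by measurable
  have img: "g ` {0<..} = {0<..}" unfolding g_def by (rule image_powr_greaterThan_0) fact+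
  have inj: "inj_on g {0<..}"
    using assms by (intro inj_on_inverseI[of _ "\<lambda>t. (t / \<gamma>) powr (- 1 / \<theta>)"])
      (auto simp: g_def powr_powr)
  have deriv: "(g has_real_derivative g' x) (at x)" if "x \<in> {0<..}" for x
    unfolding g_def g'_def using that by (auto intro!: derivative_eq_intros)
  have density: "rGB1_IWei_density \<gamma> \<theta> a b c x powr \<rho> = D * (\<bar>g' x\<bar> * G (g x))" if x: "x > 0" for x
  proof -
    \<comment> \<open>This equation dictates \<open>k\<close>: derivative times
      \<open>g x powr (k - 1)\<close> must reproduce the \<open>\<rho>\<close>-th power of
      \<open>x powr (- \<theta> - 1)\<close>.\<close>
    have exponent: "(- \<theta> - 1) + - \<theta> * (k - 1) = (- \<theta> - 1) * \<rho>"
      using assms by (simp add: k_def field_simps)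
    have "\<bar>g' x\<bar> * g x powr (k - 1) = \<theta> * (\<gamma> * \<gamma> powr (k - 1)) *
        (x powr (- \<theta> - 1) * x powr (- \<theta> * (k - 1)))"
      using assms by (simp add: g_def g'_def abs_mult powr_mult powr_powr)
    also have "x powr (- \<theta> - 1) * x powr (- \<theta> * (k - 1)) = x powr ((- \<theta> - 1) * \<rho>)"
      by (simp only: exponent flip: powr_add)
    also have "\<gamma> * \<gamma> powr (k - 1) = \<gamma> powr k" using assms by (simp add: powr_diff)
    finally have "D * (\<bar>g' x\<bar> * g x powr (k - 1)) =
        (c * \<gamma> * \<theta> / Beta a b) powr \<rho> * (x powr (- \<theta> - 1)) powr \<rho>"
      using assms by (simp add: D_def powr_powr)
    moreover have "exp (- (\<rho> * g x)) = exp (- g x) powr \<rho>"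
      by (simp add: powr_def)
    ultimately have "D * (\<bar>g' x\<bar> * G (g x)) = (c * \<gamma> * \<theta> / Beta a b) powr \<rho> * (x powr (- \<theta> - 1)) powr \<rho>
      * exp (- g x) powr \<rho> * ((1 - exp (- g x)) powr (a * c - 1)) powr \<rho>
      * ((1 - (1 - exp (- g x)) powr c) powr (b - 1)) powr \<rho>"
      unfolding G_def exp_beta_kernel_def by (simp add: powr_powr mult_ac)
    also have "\<dots> = rGB1_IWei_density \<gamma> \<theta> a b c x powr \<rho>"
      using x by (simp add: rGB1_IWei_density_def g_def powr_mult powr_divide)
    finally show ?thesis by simp
  qed
  have meas: "(\<lambda>x. \<bar>g' x\<bar> * G (g x)) \<in> borel_measurable borel"
    unfolding g_def g'_def using G_meas by measurable
  note cv = set_integral_change_of_variables_lborel[OF _ _ deriv inj G_meas meas, unfolded img]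
  have "set_integrable lborel {0<..} (\<lambda>x. D * (\<bar>g' x\<bar> * G (g x)))"
    using int density by (subst (asm) set_integrable_cong[OF refl]) auto
  then have "set_integrable lborel {0<..} (\<lambda>x. \<bar>g' x\<bar> * G (g x))"
    using D by (subst (asm) set_integrable_mult_right_iff) auto
  then show G_int: "set_integrable lborel {0<..} G" using cv(1) by simp
  have "(LINT x:{0<..}|lborel. rGB1_IWei_density \<gamma> \<theta> a b c x powr \<rho>) =
      (LINT x:{0<..}|lborel. D * (\<bar>g' x\<bar> * G (g x)))"
    using density by (intro set_lebesgue_integral_cong) auto
  also have "\<dots> = D * (LINT t:{0<..}|lborel. G t)"
    using cv(2)[OF _ _ _ G_int] by simp
  finally show "(LINT x:{0<..}|lborel. rGB1_IWei_density \<gamma> \<theta> a b c x powr \<rho>) =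
      (c * \<gamma> * \<theta> / Beta a b) powr \<rho> / (\<theta> * \<gamma> powr k) * (LINT t:{0<..}|lborel. G t)"
    by (simp add: D_def)
qed

section \<open>Assembling the entropy formula\<close>

text \<open>Summability and positivity are part of the conclusion so that the infinite sums and
  their logarithm are genuine values. The integrability hypothesis does the same for the integral in
  the entropy.\<close>

theorem proposition3:
  fixes M :: "'a measure" and X :: "'a \<Rightarrow> real" and \<gamma> \<theta> a b c \<rho> :: real
  assumes "prob_space M"
    and "0 < \<gamma>" "0 < \<theta>" "0 < a" "0 < b" "0 < c"
    and "rGB1_IWei_distributed M X \<gamma> \<theta> a b c"
    and "0 < \<rho>" "\<rho> \<noteq> 1"
    and "set_integrable lborel {0<..} (\<lambda>x. rGB1_IWei_density \<gamma> \<theta> a b c x powr \<rho>)"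
    and "0 < Gamma (\<rho> + (\<rho> - 1) / \<theta>)"
  shows "(\<forall>j1. summable (\<lambda>j2. rGB1_IWei_renyi_term \<gamma> \<theta> a b c \<rho> j1 j2)) \<and>
         summable (\<lambda>j1. \<Sum>j2. rGB1_IWei_renyi_term \<gamma> \<theta> a b c \<rho> j1 j2) \<and>
         0 < (\<Sum>j1. \<Sum>j2. rGB1_IWei_renyi_term \<gamma> \<theta> a b c \<rho> j1 j2) \<and>
         renyi_entropy M X \<rho> =
           \<rho> / (1 - \<rho>) * ln (c / Beta a b)
           + 1 / (1 - \<rho>) * ln (Gamma (\<rho> + (\<rho> - 1) / \<theta>))
           - ln (\<gamma> * \<theta>)
           + 1 / (1 - \<rho>) * ln (\<Sum>j1. \<Sum>j2. rGB1_IWei_renyi_term \<gamma> \<theta> a b c \<rho> j1 j2)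
           + 1 / (1 - \<rho>) * ln \<gamma>"
proof -
  define k where "k = \<rho> + (\<rho> - 1) / \<theta>"
  define s where "s = \<rho> * (a * c - 1) + 1"
  define u where "u = \<rho> * (b - 1) + 1"
  define G where "G = (\<lambda>t. exp_beta_kernel k \<rho> s t * (1 - (1 - exp (- t)) powr c) powr (u - 1))"
  define J where "J = (LINT t:{0<..}|lborel. G t)"
  define I where "I = (\<lambda>j. LINT t:{0<..}|lborel. exp_beta_kernel k \<rho> (s + real j * c) t)"
  define S where "S = (\<Sum>j1. \<Sum>j2. rGB1_IWei_renyi_term \<gamma> \<theta> a b c \<rho> j1 j2)"
  have \<Gamma>: "Gamma k > 0" using assms by (simp add: k_def)
  \<comment> \<open>At its poles \<open>Gamma\<close> takes the default value 0, so positivity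
    excludes them.\<close>
  then have k: "k \<notin> \<int>\<^sub>\<le>\<^sub>0" using Gamma_eq_zero_iff[of k] by auto
  have Beta_pos: "Beta a b > 0" using assms by (simp add: Beta_def)
  note cv = rGB1_IWei_density_power_change_of_variables[OF assms(2-6,10), folded k_def s_def u_def,
      folded G_def J_def]
  have ks: "k + s > 1"
    using exp_beta_kernel_weighted_integrableD[OF assms(6)] cv(1) unfolding G_def by blast
  have J: "J > 0"
    unfolding J_def
  proof (rule set_integral_pos_lborel[OF cv(1)])
    fix t :: real assume "t > 0"
    then show "G t > 0"
      using one_minus_exp_powr_in_01[of t c] assms(6) by (simp add: G_def exp_beta_kernel_def)
  qed
  have inner: "(\<lambda>j2. rGB1_IWei_renyi_term \<gamma> \<theta> a b c \<rho> j1 j2) sums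
      (binom_coeff j1 u * I j1 / (Gamma k * \<gamma> powr k))" for j1
  proof -
    have "k + (s + real j1 * c) > 1"
      using ks mult_nonneg_nonneg[of "real j1" c] assms(6) by linarith
    then have "(\<lambda>j. Gamma k * (binom_coeff j (s + real j1 * c) / (\<rho> + real j) powr k)) sums I j1"
      unfolding I_def using k assms(8) by (intro exp_beta_kernel_sums)
    then have "(\<lambda>j. binom_coeff j1 u * (Gamma k * (binom_coeff j (s + real j1 * c) / (\<rho> + real j) powr k))
        / (Gamma k * \<gamma> powr k)) sums (binom_coeff j1 u * I j1 / (Gamma k * \<gamma> powr k))"
      by (intro sums_divide sums_mult)
    moreover have "binom_coeff j1 u * (Gamma k * (binom_coeff j (s + real j1 * c) / (\<rho> + real j) powr k))
        / (Gamma k * \<gamma> powr k) = rGB1_IWei_renyi_term \<gamma> \<theta> a b c \<rho> j1 j" for j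
    proof -
      have "\<rho> * (a * c - 1) + real j1 * c + 1 = s + real j1 * c" "real j + \<rho> = \<rho> + real j"
        by (simp_all add: s_def)
      then have "rGB1_IWei_renyi_term \<gamma> \<theta> a b c \<rho> j1 j = binom_coeff j1 u *
          binom_coeff j (s + real j1 * c) / ((\<rho> + real j) * \<gamma>) powr k"
        by (simp only: rGB1_IWei_renyi_term_def k_def u_def)
      then show ?thesis using \<Gamma> by (simp add: powr_mult)
    qed
    ultimately show ?thesis by simp
  qed
  have "(\<lambda>j1. binom_coeff j1 u * I j1 / (Gamma k * \<gamma> powr k)) sums (J / (Gamma k * \<gamma> powr k))"
    unfolding I_def J_def G_def
    using assms(6,8) cv(1) by (intro sums_divide exp_beta_kernel_weighted_sums) (auto simp: G_def)
  then have outer: "(\<lambda>j1. \<Sum>j2. rGB1_IWei_renyi_term \<gamma> \<theta> a b c \<rho> j1 j2) sums (J / (Gamma k * \<gamma> powr k))"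
    using inner by (simp add: sums_iff)
  then have S: "S = J / (Gamma k * \<gamma> powr k)" by (simp add: S_def sums_iff)
  have S_pos: "S > 0" unfolding S using J \<Gamma> assms by simp
  \<comment> \<open>The factor \<open>\<gamma> powr k\<close> in the denominator of the substitution
    constant cancels against the one in \<open>J = Gamma k * \<gamma> powr k * S\<close>.\<close>
  have "(LINT x:{0<..}|lborel. rGB1_IWei_density \<gamma> \<theta> a b c x powr \<rho>) =
      (c / Beta a b * (\<gamma> * \<theta>)) powr \<rho> / \<theta> * Gamma k * S"
    unfolding cv(2) S using \<Gamma> assms by (simp add: mult_ac)
  also have "ln \<dots> = \<rho> * (ln (c / Beta a b) + ln (\<gamma> * \<theta>)) - ln \<theta> + ln (Gamma k) + ln S"
    using assms Beta_pos \<Gamma> S_pos by (simp add: ln_mult_pos ln_div ln_powr)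
  finally have ln_int: "ln (LINT x:{0<..}|lborel. rGB1_IWei_density \<gamma> \<theta> a b c x powr \<rho>) =
      \<rho> * (ln (c / Beta a b) + ln (\<gamma> * \<theta>)) - ln \<theta> + ln (Gamma k) + ln S" .
  have density_nonneg: "rGB1_IWei_density \<gamma> \<theta> a b c x \<ge> 0" for x
    using assms Beta_pos by (simp add: rGB1_IWei_density_def)
  have density_meas: "rGB1_IWei_density \<gamma> \<theta> a b c \<in> borel_measurable borel"
    unfolding rGB1_IWei_density_def[abs_def] by measurable
  have "renyi_entropy M X \<rho> =
      1 / (1 - \<rho>) * (\<rho> * (ln (c / Beta a b) + ln (\<gamma> * \<theta>)) - ln \<theta> + ln (Gamma k) + ln S)"
    unfolding ln_int[symmetric]
    by (rule renyi_entropy_distributed[OF assms(7)[unfolded rGB1_IWei_distributed_def]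
          density_nonneg density_meas])
  also have "\<dots> = \<rho> / (1 - \<rho>) * ln (c / Beta a b) + 1 / (1 - \<rho>) * ln (Gamma k) - ln (\<gamma> * \<theta>)
      + 1 / (1 - \<rho>) * ln S + 1 / (1 - \<rho>) * ln \<gamma>"
  proof -
    \<comment> \<open>Since \<open>\<rho> / (1 - \<rho>) = 1 / (1 - \<rho>) - 1\<close>, splitting
      off \<open>- ln (\<gamma> * \<theta>)\<close> leaves
      \<open>ln (\<gamma> * \<theta>) - ln \<theta>\<close> over \<open>1 - \<rho>\<close>: the
      summand with \<open>ln \<gamma>\<close>.\<close>
    have "ln \<theta> = ln (\<gamma> * \<theta>) - ln \<gamma>" using assms by (simp add: ln_mult_pos)
    then show ?thesis using assms(9) by (simp add: divide_simps) (simp add: algebra_simps)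
  qed
  finally show ?thesis
    using inner outer S_pos unfolding S_def k_def by (auto intro: sums_summable)
qed

end
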